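(* Let $2\le n<m$ be integers, let $I\subseteq\mathbb{R}$ be an interval, and let $f_1,f_2:I\to\mathbb{R}$ be continuous and strictly monotone. For $r\in\{1,2\}$ let $K_r:I^n\to I$ be the $n$-variable quasi-arithmetic mean generated by $f_r$, and let $K_r^{(m)}:I^m\to I$ be the associated $m$-variable quasi-arithmetic mean (generated by the same $f_r$). If $K_1(x_1,\dots,x_n)\le K_2(x_1,\dots,x_n)$ for all $x_1,\dots,x_n\in I$, then $K_1^{(m)}(x_1,\dots,x_m)\le K_2^{(m)}(x_1,\dots,x_m)$ for all $x_1,\dots,x_m\in I$.
   Context: For a continuous strictly monotone function $f:I\to\mathbb{R}$ on an interval $I$ and an integer $p\ge 1$, the $p$-variable quasi-arithmetic mean generated by $f$ is $(x_1,\dots,x_p)\mapsto f^{-1}\Big(\frac{f(x_1)+\dots+f(x_p)}{p}\Big)$ on $I^p$. *)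

theory Defs
  imports "HOL-Analysis.Analysis"
begin

definition strictly_monotone_on :: "real set \<Rightarrow> (real \<Rightarrow> real) \<Rightarrow> bool" where
  "strictly_monotone_on I f \<longleftrightarrow> strict_mono_on I f \<or> strict_antimono_on I f"

text \<open>A point of \<open>I\<^sup>p\<close> is a function \<open>x :: nat \<Rightarrow> real\<close> of which only the
  coordinates \<open>x 1, \<dots>, x p\<close>, all lying in \<open>I\<close>, are relevant.  The inverse is that of the
  restriction of \<open>f\<close> to \<open>I\<close>, as \<open>f\<close> is unconstrained outside \<open>I\<close>.\<close>

definition quasi_arithmetic_mean ::
    "real set \<Rightarrow> (real \<Rightarrow> real) \<Rightarrow> nat \<Rightarrow> (nat \<Rightarrow> real) \<Rightarrow> real" where
  "quasi_arithmetic_mean I f p x = the_inv_into I f ((\<Sum>i=1..p. f (x i)) / real p)"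

text \<open>The inverse is only ever applied to values in the image of \<open>I\<close>, so the mean is a genuine
  map from \<open>I\<^sup>p\<close> to \<open>I\<close>.\<close>

lemma strictly_monotone_on_imp_inj_on: "strictly_monotone_on I f \<Longrightarrow> inj_on f I"
  unfolding strictly_monotone_on_def inj_on_def monotone_on_def
  by (metis less_irrefl linorder_neqE)

lemma quasi_arithmetic_mean_well_defined:
  assumes "is_interval I" "continuous_on I f" "strictly_monotone_on I f" "p \<ge> 1"
    and x: "\<And>i. i \<in> {1..p} \<Longrightarrow> x i \<in> I"
  shows "quasi_arithmetic_mean I f p x \<in> I"
    and "f (quasi_arithmetic_mean I f p x) = (\<Sum>i=1..p. f (x i)) / real p"
proof -
  have "convex (f ` I)"
    using assms(1,2) connected_continuous_image is_interval_connected_1 is_interval_convex_1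
    by metis
  then have "(\<Sum>i\<in>{1..p}. (1 / real p) *\<^sub>R f (x i)) \<in> f ` I"
    using assms(4) x by (intro convex_sum) auto
  then have im: "(\<Sum>i=1..p. f (x i)) / real p \<in> f ` I"
    by (simp add: sum_divide_distrib)
  note inj = strictly_monotone_on_imp_inj_on[OF assms(3)]
  show "quasi_arithmetic_mean I f p x \<in> I"
    unfolding quasi_arithmetic_mean_def by (rule the_inv_into_into[OF inj im]) simp
  show "f (quasi_arithmetic_mean I f p x) = (\<Sum>i=1..p. f (x i)) / real p"
    unfolding quasi_arithmetic_mean_def by (rule f_the_inv_into_f[OF inj im])
qed

end

theory Submission imports Defs begin

text \<open>
  The proof is Cauchy's forward and backward argument for the inequality of arithmetic and
  geometric means, carried out for quasi-arithmetic means.  The first mean is the one generated by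
  \<open>f1\<close>, the second mean the one generated by \<open>f2\<close>.

  Going up: the mean of \<open>p * q\<close> numbers is the \<open>p\<close>-variable mean of the \<open>q\<close>-variable means of
  \<open>p\<close> consecutive blocks of length \<open>q\<close>, and every mean is monotone in each variable.  So a
  comparison in \<open>p\<close> variables and one in \<open>q\<close> variables combine to a comparison in \<open>p * q\<close>
  variables (\<open>mean_le_mult\<close>), and the hypothesis yields one in \<open>n ^ k\<close> variables for every \<open>k\<close>.

  Going down: since \<open>n \<ge> 2\<close>, some power of \<open>n\<close> exceeds \<open>m\<close>.  Filling up
  \<open>m\<close> numbers with copies of their first mean \<open>\<mu>\<close> does not change that mean, so the comparison
  for the longer tuple says that \<open>\<mu>\<close> is at most the second mean of the filled-up tuple.
  That second mean is a weighted quasi-arithmetic mean, with the same generator, of \<open>\<mu>\<close> and the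
  second mean of the original numbers, so the latter cannot lie below \<open>\<mu>\<close>
  (\<open>mean_le_antimono\<close>).
\<close>

lemma strictly_monotone_on_le_cases:
  assumes "strictly_monotone_on I f"
  obtains (increasing) "\<And>a b. a \<in> I \<Longrightarrow> b \<in> I \<Longrightarrow> f a \<le> f b \<longleftrightarrow> a \<le> b"
    | (decreasing) "\<And>a b. a \<in> I \<Longrightarrow> b \<in> I \<Longrightarrow> f b \<le> f a \<longleftrightarrow> a \<le> b"
proof -
  from assms consider "strict_mono_on I f" | "strict_antimono_on I f"
    unfolding strictly_monotone_on_def by blast
  then show thesis
  proof cases
    case 1
    show thesis by (rule increasing) (rule strict_mono_on_less_eq[OF 1])
  next
    case 2
    have "f b \<le> f a \<longleftrightarrow> a \<le> b" if "a \<in> I" "b \<in> I" for a b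
      using monotone_onD[OF 2, of a b] monotone_onD[OF 2, of b a] that
      by (cases a b rule: linorder_cases) auto
    then show thesis by (rule decreasing)
  qed
qed

lemma sum_blocks:
  fixes h :: "nat \<Rightarrow> 'a::comm_monoid_add"
  shows "(\<Sum>i=1..p*q. h i) = (\<Sum>b=1..p. \<Sum>j=1..q. h ((b - 1) * q + j))"
proof (induction p)
  case (Suc p)
  have "(\<Sum>i=1..Suc p * q. h i) = (\<Sum>i=1..p*q. h i) + (\<Sum>i=p*q+1..p*q+q. h i)"
    using sum.ub_add_nat[of 1 "p * q" h q] by (simp add: add.commute)
  also have "(\<Sum>i=p*q+1..p*q+q. h i) = (\<Sum>j=1..q. h (p * q + j))"
    using sum.shift_bounds_cl_nat_ivl[of h 1 "p * q" q] by (simp add: add.commute)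
  finally show ?case using Suc by simp
qed simp

lemma block_index_in_range:
  fixes b j :: nat
  assumes "b \<in> {1..p}" "j \<in> {1..q}"
  shows "(b - 1) * q + j \<in> {1..p * q}"
proof -
  have "(b - 1) * q + j \<le> (b - 1) * q + q" using assms by simp
  also have "\<dots> = b * q" using assms by (cases b) auto
  also have "\<dots> \<le> p * q" using assms by simp
  finally show ?thesis using assms by simp
qed

locale mean_generator =
  fixes I :: "real set" and f :: "real \<Rightarrow> real"
  assumes interval: "is_interval I" and cont: "continuous_on I f"
    and mono: "strictly_monotone_on I f"
begin

abbreviation M :: "nat \<Rightarrow> (nat \<Rightarrow> real) \<Rightarrow> real" where
  "M \<equiv> quasi_arithmetic_mean I f"

lemmas mean_mem = quasi_arithmetic_mean_well_defined(1)[OF interval cont mono]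
lemmas f_mean = quasi_arithmetic_mean_well_defined(2)[OF interval cont mono]

lemma sum_eq_f_mean:
  assumes "p \<ge> 1" "\<And>i. i \<in> {1..p} \<Longrightarrow> x i \<in> I"
  shows "(\<Sum>i=1..p. f (x i)) = real p * f (M p x)"
  using f_mean[OF assms] assms(1) by simp

lemma mean_eqI:
  assumes "c \<in> I" "p \<ge> 1" "(\<Sum>i=1..p. f (x i)) = real p * f c"
  shows "M p x = c"
  using assms the_inv_into_f_f[OF strictly_monotone_on_imp_inj_on[OF mono]]
  by (simp add: quasi_arithmetic_mean_def)

lemma mean_mono:
  assumes "p \<ge> 1" and x: "\<And>i. i \<in> {1..p} \<Longrightarrow> x i \<in> I" and y: "\<And>i. i \<in> {1..p} \<Longrightarrow> y i \<in> I"
    and le: "\<And>i. i \<in> {1..p} \<Longrightarrow> x i \<le> y i"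
  shows "M p x \<le> M p y"
proof -
  have mem: "M p x \<in> I" "M p y \<in> I"
    using x y \<open>p \<ge> 1\<close> by (blast intro: mean_mem)+
  have f_means: "f (M p x) = (\<Sum>i=1..p. f (x i)) / real p"
      "f (M p y) = (\<Sum>i=1..p. f (y i)) / real p"
    using x y \<open>p \<ge> 1\<close> by (blast intro: f_mean)+
  from mono show ?thesis
  proof (cases rule: strictly_monotone_on_le_cases)
    case increasing
    have "(\<Sum>i=1..p. f (x i)) \<le> (\<Sum>i=1..p. f (y i))"
      using x y le increasing by (intro sum_mono) blast
    then have "f (M p x) \<le> f (M p y)" unfolding f_means by (rule divide_right_mono) simp
    then show ?thesis using increasing mem by blast
  next
    case decreasing
    have "(\<Sum>i=1..p. f (y i)) \<le> (\<Sum>i=1..p. f (x i))"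
      using x y le decreasing by (intro sum_mono) blast
    then have "f (M p y) \<le> f (M p x)" unfolding f_means by (rule divide_right_mono) simp
    then show ?thesis using decreasing mem by blast
  qed
qed

lemma mean_of_blocks:
  assumes "p \<ge> 1" "q \<ge> 1" and x: "\<And>i. i \<in> {1..p * q} \<Longrightarrow> x i \<in> I"
  shows "M (p * q) x = M p (\<lambda>b. M q (\<lambda>j. x ((b - 1) * q + j)))" (is "_ = M p ?y")
proof (rule mean_eqI)
  have block: "x ((b - 1) * q + j) \<in> I" if "b \<in> {1..p}" "j \<in> {1..q}" for b j
    using x block_index_in_range that by blast
  have y: "?y b \<in> I" if "b \<in> {1..p}" for b
    using that \<open>q \<ge> 1\<close> block by (intro mean_mem) auto
  show "M p ?y \<in> I" using \<open>p \<ge> 1\<close> y by (rule mean_mem)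
  show "p * q \<ge> 1" using assms by simp
  have "(\<Sum>i=1..p * q. f (x i)) = (\<Sum>b=1..p. \<Sum>j=1..q. f (x ((b - 1) * q + j)))"
    by (rule sum_blocks)
  also have "\<dots> = (\<Sum>b=1..p. real q * f (?y b))"
    using \<open>q \<ge> 1\<close> block by (intro sum.cong refl sum_eq_f_mean) auto
  also have "\<dots> = real q * (real p * f (M p ?y))"
    unfolding sum_distrib_left[symmetric] using sum_eq_f_mean[of p ?y] \<open>p \<ge> 1\<close> y by simp
  finally show "(\<Sum>i=1..p * q. f (x i)) = real (p * q) * f (M p ?y)" by simp
qed

lemma sum_padded:
  assumes "m \<ge> 1" "m \<le> N" and x: "\<And>i. i \<in> {1..m} \<Longrightarrow> x i \<in> I"
  shows "(\<Sum>i=1..N. f (if i \<le> m then x i else c)) = real m * f (M m x) + real (N - m) * f c"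
proof -
  let ?y = "\<lambda>i. if i \<le> m then x i else c"
  have "(\<Sum>i=1..N. f (?y i)) = (\<Sum>i=1..m. f (?y i)) + (\<Sum>i=m+1..N. f (?y i))"
    using sum.ub_add_nat[of 1 m "\<lambda>i. f (?y i)" "N - m"] \<open>m \<le> N\<close> by simp
  also have "(\<Sum>i=1..m. f (?y i)) = (\<Sum>i=1..m. f (x i))" by (rule sum.cong) auto
  also have "\<dots> = real m * f (M m x)" by (rule sum_eq_f_mean[OF \<open>m \<ge> 1\<close> x])
  also have "(\<Sum>i=m+1..N. f (?y i)) = (\<Sum>i=m+1..N. f c)" by (rule sum.cong) auto
  finally show ?thesis by simp
qed

end

locale two_mean_generators =
  g1: mean_generator I f1 + g2: mean_generator I f2 for I f1 f2
begin

definition mean_le :: "nat \<Rightarrow> bool" where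
  "mean_le p \<longleftrightarrow> (\<forall>x. (\<forall>i\<in>{1..p}. x i \<in> I) \<longrightarrow> g1.M p x \<le> g2.M p x)"

lemma mean_leD: "mean_le p \<Longrightarrow> (\<And>i. i \<in> {1..p} \<Longrightarrow> x i \<in> I) \<Longrightarrow> g1.M p x \<le> g2.M p x"
  unfolding mean_le_def by blast

text \<open>The first mean of all entries is the first mean of the first block means; the comparison in
  \<open>p\<close> variables replaces the outer mean, and the one in \<open>q\<close> variables, through monotonicity of the
  outer mean, the inner ones.\<close>

lemma mean_le_mult:
  assumes "p \<ge> 1" "q \<ge> 1" "mean_le p" "mean_le q"
  shows "mean_le (p * q)"
  unfolding mean_le_def
proof (intro allI impI)
  fix x :: "nat \<Rightarrow> real"
  assume "\<forall>i\<in>{1..p * q}. x i \<in> I"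
  then have x: "x i \<in> I" if "i \<in> {1..p * q}" for i using that by blast
  define B where "B b j = x ((b - 1) * q + j)" for b j
  have B: "B b j \<in> I" if "b \<in> {1..p}" "j \<in> {1..q}" for b j
    using x block_index_in_range that unfolding B_def by blast
  have B1: "g1.M q (B b) \<in> I" if "b \<in> {1..p}" for b
    using that B \<open>q \<ge> 1\<close> by (intro g1.mean_mem)
  have B2: "g2.M q (B b) \<in> I" if "b \<in> {1..p}" for b
    using that B \<open>q \<ge> 1\<close> by (intro g2.mean_mem)
  have "g1.M (p * q) x = g1.M p (\<lambda>b. g1.M q (B b))"
    unfolding B_def by (rule g1.mean_of_blocks[OF assms(1,2) x])
  also have "\<dots> \<le> g2.M p (\<lambda>b. g1.M q (B b))"
    by (rule mean_leD[OF \<open>mean_le p\<close> B1])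
  also have "\<dots> \<le> g2.M p (\<lambda>b. g2.M q (B b))"
    using B by (intro g2.mean_mono[OF \<open>p \<ge> 1\<close>] B1 B2 mean_leD[OF \<open>mean_le q\<close>])
  also have "\<dots> = g2.M (p * q) x"
    unfolding B_def by (rule g2.mean_of_blocks[OF assms(1,2) x, symmetric])
  finally show "g1.M (p * q) x \<le> g2.M (p * q) x" .
qed

lemma mean_le_power:
  assumes "n \<ge> 1" "mean_le n"
  shows "mean_le (n ^ Suc k)"
proof (induction k)
  case (Suc k)
  show ?case
    unfolding power_Suc[of n "Suc k"] using assms Suc by (intro mean_le_mult) auto
qed (use assms in simp)

text \<open>Padding with the first mean \<open>\<mu>\<close> keeps the first mean equal to \<open>\<mu>\<close>, while in terms of the
  generator the second mean of the padded tuple is a convex combination of \<open>\<mu>\<close> and the second mean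
  of \<open>x\<close>, the latter having positive weight \<open>m / N\<close>.\<close>

lemma mean_le_antimono:
  assumes "m \<ge> 1" "m \<le> N" "mean_le N"
  shows "mean_le m"
  unfolding mean_le_def
proof (intro allI impI)
  fix x :: "nat \<Rightarrow> real"
  assume "\<forall>i\<in>{1..m}. x i \<in> I"
  then have x: "x i \<in> I" if "i \<in> {1..m}" for i using that by blast
  have "N \<ge> 1" using assms by simp
  define \<mu> where "\<mu> = g1.M m x"
  define y where "y i = (if i \<le> m then x i else \<mu>)" for i
  have \<mu>: "\<mu> \<in> I" unfolding \<mu>_def using x \<open>m \<ge> 1\<close> by (intro g1.mean_mem)
  have y: "y i \<in> I" if "i \<in> {1..N}" for i using x \<mu> that by (auto simp: y_def)
  have N: "real N = real m + real (N - m)" using \<open>m \<le> N\<close> by simp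
  have "(\<Sum>i=1..N. f1 (y i)) = real N * f1 \<mu>"
    using g1.sum_padded[OF assms(1,2) x, where c = \<mu>] unfolding y_def N
    by (simp add: \<mu>_def[symmetric] algebra_simps)
  then have "g1.M N y = \<mu>" by (rule g1.mean_eqI[OF \<mu> \<open>N \<ge> 1\<close>])
  then have le: "\<mu> \<le> g2.M N y" using mean_leD[of N y] \<open>mean_le N\<close> y by simp
  have "real N * f2 (g2.M N y) = real m * f2 (g2.M m x) + real (N - m) * f2 \<mu>"
    using g2.sum_eq_f_mean[of N y] \<open>N \<ge> 1\<close> y g2.sum_padded[OF assms(1,2) x, where c = \<mu>]
    by (simp add: y_def[abs_def])
  then have comb: "real m * (f2 (g2.M m x) - f2 \<mu>) = real N * (f2 (g2.M N y) - f2 \<mu>)"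
    unfolding N by (simp add: algebra_simps)
  have mem: "g2.M m x \<in> I" "g2.M N y \<in> I"
    by (rule g2.mean_mem[OF \<open>m \<ge> 1\<close> x] g2.mean_mem[OF \<open>N \<ge> 1\<close> y]; assumption)+
  from g2.mono have "\<mu> \<le> g2.M m x"
  proof (cases rule: strictly_monotone_on_le_cases)
    case increasing
    then have "0 \<le> real m * (f2 (g2.M m x) - f2 \<mu>)" unfolding comb using le \<mu> mem by simp
    then have "f2 \<mu> \<le> f2 (g2.M m x)" using \<open>m \<ge> 1\<close> by (simp add: zero_le_mult_iff)
    then show ?thesis using increasing \<mu> mem by blast
  next
    case decreasing
    then have "real m * (f2 (g2.M m x) - f2 \<mu>) \<le> 0"
      unfolding comb using le \<mu> mem by (simp add: mult_nonneg_nonpos)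
    then have "f2 (g2.M m x) \<le> f2 \<mu>" using \<open>m \<ge> 1\<close> by (simp add: mult_le_0_iff)
    then show ?thesis using decreasing \<mu> mem by blast
  qed
  then show "g1.M m x \<le> g2.M m x" by (simp add: \<mu>_def)
qed

end

theorem theorem2p16:
  fixes n m :: nat and I :: "real set" and f1 f2 :: "real \<Rightarrow> real"
  assumes "2 \<le> n" and "n < m"
    and "is_interval I"
    and "continuous_on I f1" and "strictly_monotone_on I f1"
    and "continuous_on I f2" and "strictly_monotone_on I f2"
    and "\<And>x :: nat \<Rightarrow> real. (\<forall>i\<in>{1..n}. x i \<in> I) \<Longrightarrow>
           quasi_arithmetic_mean I f1 n x \<le> quasi_arithmetic_mean I f2 n x"
  shows "\<forall>x :: nat \<Rightarrow> real. (\<forall>i\<in>{1..m}. x i \<in> I) \<longrightarrow>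
           quasi_arithmetic_mean I f1 m x \<le> quasi_arithmetic_mean I f2 m x"
proof -
  interpret two_mean_generators I f1 f2
    using assms by unfold_locales
  have "mean_le n" unfolding mean_le_def using assms(8) by blast
  then have "mean_le (n ^ Suc m)" using assms(1) by (intro mean_le_power) simp
  moreover have "m \<le> n ^ Suc m"
    using power_gt_expt[of n "Suc m"] assms(1) by simp
  ultimately have "mean_le m" using assms(1,2) by (intro mean_le_antimono[of m "n ^ Suc m"]) auto
  then show ?thesis unfolding mean_le_def .
qed

end
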